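(* Let $G$ be a computable graph that has at least one isolated vertex but is not isomorphic to $\overline{K}_\omega$. If the set of vertices of $G$ with finite degree is computably enumerable, then there is a computable partition of the vertex set $G=X_0\sqcup X_1$ such that neither the induced subgraph on $X_0$ nor the induced subgraph on $X_1$ is computably isomorphic to $G$.
   Context: A graph is a set of vertices $V\subseteq\mathbb{N}$ with an irreflexive symmetric edge relation; it is computable if $V$ and the edge relation are computable. A vertex is isolated if it has no neighbors; its degree is the number of its neighbors. $\overline{K}_\omega$ is the edgeless graph on $\mathbb{N}$. A computable isomorphism is an isomorphism given by a computable function.
   Formalization: The one-vertex graph is excluded: it satisfies all the hypotheses, but in any partition of its vertex set one part is the whole graph, so the claim as written fails for it. *)

theory Defs
  imports Main "HOL-Library.Nat_Bijection"
begin

text \<open>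
  Kleene's partial recursive functions, presented as unary functions: several arguments are
  packed into one by the Cantor pairing \<^const>\<open>prod_encode\<close>, and \<^const>\<open>None\<close> stands for divergence.
\<close>

text \<open>
  Unbounded search for the least zero of \<open>f(a, _)\<close>.  As usual for partial \<open>f\<close>, the search
  diverges if it meets an undefined value before the first zero.
\<close>

definition mu_search :: "(nat \<Rightarrow> nat option) \<Rightarrow> nat \<Rightarrow> nat option" where
  "mu_search f a =
     (if \<exists>n. f (prod_encode (a, n)) = Some 0 \<and> (\<forall>m<n. f (prod_encode (a, m)) \<noteq> None)
      then Some (LEAST n. f (prod_encode (a, n)) = Some 0)
      else None)"

fun prim_rec :: "(nat \<Rightarrow> nat option) \<Rightarrow> (nat \<Rightarrow> nat option) \<Rightarrow> nat \<Rightarrow> nat \<Rightarrow> nat option" where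
  "prim_rec f g a 0 = f a"
| "prim_rec f g a (Suc k) =
     Option.bind (prim_rec f g a k) (\<lambda>r. g (prod_encode (a, prod_encode (k, r))))"

inductive partial_computable :: "(nat \<Rightarrow> nat option) \<Rightarrow> bool" where
  zero: "partial_computable (\<lambda>n. Some 0)"
| succ: "partial_computable (\<lambda>n. Some (Suc n))"
| left: "partial_computable (\<lambda>n. Some (fst (prod_decode n)))"
| right: "partial_computable (\<lambda>n. Some (snd (prod_decode n)))"
| pair: "partial_computable f \<Longrightarrow> partial_computable g \<Longrightarrow>
    partial_computable
      (\<lambda>n. Option.bind (f n) (\<lambda>x. Option.bind (g n) (\<lambda>y. Some (prod_encode (x, y)))))"
| comp: "partial_computable f \<Longrightarrow> partial_computable g \<Longrightarrow>
    partial_computable (\<lambda>n. Option.bind (g n) f)"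
| prec: "partial_computable f \<Longrightarrow> partial_computable g \<Longrightarrow>
    partial_computable (\<lambda>n. prim_rec f g (fst (prod_decode n)) (snd (prod_decode n)))"
| mu: "partial_computable f \<Longrightarrow> partial_computable (mu_search f)"

definition computable :: "(nat \<Rightarrow> nat) \<Rightarrow> bool" where
  "computable f \<longleftrightarrow> partial_computable (\<lambda>n. Some (f n))"

definition computable_set :: "nat set \<Rightarrow> bool" where
  "computable_set A \<longleftrightarrow> computable (\<lambda>n. if n \<in> A then 1 else 0)"

definition computable_rel :: "(nat \<times> nat) set \<Rightarrow> bool" where
  "computable_rel R \<longleftrightarrow> computable_set (prod_encode ` R)"

definition comp_enumerable :: "nat set \<Rightarrow> bool" where
  "comp_enumerable A \<longleftrightarrow> (\<exists>f. partial_computable f \<and> A = dom f)"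

record graph =
  verts :: "nat set"
  edges :: "(nat \<times> nat) set"

definition is_graph :: "graph \<Rightarrow> bool" where
  "is_graph G \<longleftrightarrow> edges G \<subseteq> verts G \<times> verts G \<and> irrefl (edges G) \<and> sym (edges G)"

definition computable_graph :: "graph \<Rightarrow> bool" where
  "computable_graph G \<longleftrightarrow> is_graph G \<and> computable_set (verts G) \<and> computable_rel (edges G)"

definition neighbours :: "graph \<Rightarrow> nat \<Rightarrow> nat set" where
  "neighbours G v = {u \<in> verts G. (v, u) \<in> edges G}"

definition isolated :: "graph \<Rightarrow> nat \<Rightarrow> bool" where
  "isolated G v \<longleftrightarrow> v \<in> verts G \<and> neighbours G v = {}"

definition finite_degree_verts :: "graph \<Rightarrow> nat set" where
  "finite_degree_verts G = {v \<in> verts G. finite (neighbours G v)}"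

definition edgeless_omega :: graph where
  "edgeless_omega = \<lparr>verts = UNIV, edges = {}\<rparr>"

definition induced_subgraph :: "graph \<Rightarrow> nat set \<Rightarrow> graph" where
  "induced_subgraph G X = \<lparr>verts = X, edges = edges G \<inter> X \<times> X\<rparr>"

definition graph_iso :: "(nat \<Rightarrow> nat) \<Rightarrow> graph \<Rightarrow> graph \<Rightarrow> bool" where
  "graph_iso f G H \<longleftrightarrow>
     bij_betw f (verts G) (verts H) \<and>
     (\<forall>x\<in>verts G. \<forall>y\<in>verts G. (x, y) \<in> edges G \<longleftrightarrow> (f x, f y) \<in> edges H)"

definition isomorphic :: "graph \<Rightarrow> graph \<Rightarrow> bool" where
  "isomorphic G H \<longleftrightarrow> (\<exists>f. graph_iso f G H)"

text \<open>
  The values of \<open>f\<close> off \<open>verts G\<close> are irrelevant.  Taking \<open>f\<close> total loses nothing for graphs with a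
  computable vertex set: a partial computable function whose domain contains that set can be
  redefined as \<open>0\<close> elsewhere.
\<close>

definition computably_isomorphic :: "graph \<Rightarrow> graph \<Rightarrow> bool" where
  "computably_isomorphic G H \<longleftrightarrow> (\<exists>f. computable f \<and> graph_iso f G H)"

definition computable_partition :: "nat set \<Rightarrow> nat set \<Rightarrow> nat set \<Rightarrow> bool" where
  "computable_partition V X0 X1 \<longleftrightarrow>
     computable_set X0 \<and> computable_set X1 \<and> X0 \<union> X1 = V \<and> X0 \<inter> X1 = {}"

end

theory Submission
  imports Defs "HOL-Library.Infinite_Set"
begin

text \<open>
  If the set of isolated vertices is computable, split \<open>G\<close> into its isolated and its non-isolated
  vertices: the first part is edgeless and the second has no isolated vertex.  If some vertex has
  infinite degree, decide vertices in increasing order: a vertex with an edge to \<open>X0\<close> goes to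
  \<open>X0\<close>; for any other one wait until it either gets enumerated as having finite degree, and goes to
  \<open>X1\<close>, or shows a larger neighbour, and goes to \<open>X0\<close>.  Then \<open>X0\<close> has no isolated vertex and
  \<open>X1\<close> is locally finite.

  There remains the locally finite case with a noncomputable set of isolated vertices, which needs
  a finite injury argument.  To keep the \<open>e\<close>-th computable function \<open>\<phi>\<close> from being an isomorphism of
  \<open>G\<close> onto the subgraph on \<open>Xi\<close>, freeze each value \<open>\<phi> u\<close> as soon as \<open>u\<close> and \<open>\<phi> u\<close> look alike
  (both isolated so far, or both not) on a longer and longer initial segment: later neighbours of
  \<open>\<phi> u\<close> are sent to the other part.  If this went on forever, then \<open>u\<close> would be isolated as soon as
  it still looks isolated when \<open>\<phi> u\<close> gets frozen, up to the finitely many exceptions caused by stronger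
  requirements, and the set of isolated vertices would be computable.  So each requirement freezes
  only finitely many vertices, each with only finitely many neighbours.
\<close>

section \<open>Closure properties of computable functions\<close>

abbreviation pfst :: "nat \<Rightarrow> nat" where "pfst z \<equiv> fst (prod_decode z)"
abbreviation psnd :: "nat \<Rightarrow> nat" where "psnd z \<equiv> snd (prod_decode z)"

lemma computable_pfst0: "computable (\<lambda>x. pfst x)"
  unfolding computable_def by (rule partial_computable.left)

lemma computable_psnd0: "computable (\<lambda>x. psnd x)"
  unfolding computable_def by (rule partial_computable.right)

lemma computable_compose:
  assumes "computable f" "computable g"
  shows "computable (\<lambda>x. f (g x))"
  using partial_computable.comp[of "\<lambda>x. Some (f x)" "\<lambda>x. Some (g x)"] assms
  unfolding computable_def by simp

lemma computable_pair:
  assumes "computable f" "computable g"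
  shows "computable (\<lambda>x. prod_encode (f x, g x))"
  using partial_computable.pair[of "\<lambda>x. Some (f x)" "\<lambda>x. Some (g x)"] assms
  unfolding computable_def by simp

lemma computable_id: "computable (\<lambda>x. x)"
  using computable_pair[OF computable_pfst0 computable_psnd0] by simp

lemma computable_pfst: "computable f \<Longrightarrow> computable (\<lambda>x. pfst (f x))"
  by (rule computable_compose[OF computable_pfst0])

lemma computable_psnd: "computable f \<Longrightarrow> computable (\<lambda>x. psnd (f x))"
  by (rule computable_compose[OF computable_psnd0])

lemma computable_Suc: "computable f \<Longrightarrow> computable (\<lambda>x. Suc (f x))"
  by (rule computable_compose[of Suc]) (simp_all add: computable_def partial_computable.succ)

lemma computable_const: "computable (\<lambda>x. c)"
  by (induction c) (simp_all add: computable_def[of "\<lambda>x. 0"] partial_computable.zero computable_Suc)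

lemma prim_rec_total:
  "prim_rec (\<lambda>x. Some (f x)) (\<lambda>x. Some (g x)) a k =
     Some (rec_nat (f a) (\<lambda>k r. g (prod_encode (a, prod_encode (k, r)))) k)"
  by (induction k) simp_all

text \<open>The parameter \<open>x\<close> rides along with the counter, so \<open>g\<close> may
  depend on it; arithmetic, conditionals and bounded quantifiers all reduce to this form.\<close>

lemma computable_rec_nat:
  assumes "computable f" "computable n"
    and "computable (\<lambda>z. g (pfst z) (pfst (psnd z)) (psnd (psnd z)))"
  shows "computable (\<lambda>x. rec_nat (f x) (\<lambda>k r. g x k r) (n x))"
proof -
  let ?h = "\<lambda>z. rec_nat (f (pfst z)) (\<lambda>k r. g (pfst z) k r) (psnd z)"
  have "computable ?h"
    using partial_computable.prec[of "\<lambda>x. Some (f x)"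
        "\<lambda>z. Some (g (pfst z) (pfst (psnd z)) (psnd (psnd z)))"] assms(1,3)
    unfolding computable_def by (simp add: prim_rec_total)
  from computable_compose[OF this computable_pair[OF computable_id assms(2)]]
  show ?thesis by simp
qed

definition decidable :: "(nat \<Rightarrow> bool) \<Rightarrow> bool" where
  "decidable P \<longleftrightarrow> computable (\<lambda>x. of_bool (P x))"

lemma computable_add:
  assumes "computable f" "computable g"
  shows "computable (\<lambda>x. f x + g x)"
proof -
  have "computable (\<lambda>x. rec_nat (f x) (\<lambda>k r. Suc r) (g x))"
    by (intro computable_rec_nat computable_Suc computable_psnd computable_id assms)
  moreover have "rec_nat a (\<lambda>k r. Suc r) b = a + b" for a b :: nat
    by (induction b) simp_all
  ultimately show ?thesis
    by simp
qed

lemma computable_mult: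
  assumes "computable f" "computable g"
  shows "computable (\<lambda>x. f x * g x)"
proof -
  have "computable (\<lambda>x. rec_nat 0 (\<lambda>k r. r + f x) (g x))"
    by (intro computable_rec_nat computable_add computable_const computable_psnd computable_id
      computable_compose[OF assms(1) computable_pfst0] assms)
  moreover have "rec_nat 0 (\<lambda>k r. r + a) b = a * b" for a b :: nat
    by (induction b) simp_all
  ultimately show ?thesis
    by simp
qed

lemma computable_minus:
  assumes "computable f" "computable g"
  shows "computable (\<lambda>x. f x - g x)"
proof -
  have pred: "computable (\<lambda>x. h x - 1)" if "computable h" for h
  proof -
    have "computable (\<lambda>x. rec_nat 0 (\<lambda>k r. k) (h x))"
      by (intro computable_rec_nat computable_const computable_pfst computable_psnd computable_id that)
    moreover have "rec_nat 0 (\<lambda>k r. k) a = a - 1" for a :: nat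
      by (induction a) simp_all
    ultimately show ?thesis
      by simp
  qed
  have "computable (\<lambda>x. rec_nat (f x) (\<lambda>k r. r - 1) (g x))"
    by (intro computable_rec_nat pred computable_psnd computable_id assms)
  moreover have "rec_nat a (\<lambda>k r. r - 1) b = a - b" for a b :: nat
    by (induction b) simp_all
  ultimately show ?thesis
    by simp
qed

lemma computable_power:
  assumes "computable f" "computable g"
  shows "computable (\<lambda>x. f x ^ g x)"
proof -
  have "computable (\<lambda>x. rec_nat 1 (\<lambda>k r. r * f x) (g x))"
    by (intro computable_rec_nat computable_mult computable_const computable_psnd computable_id
      computable_compose[OF assms(1) computable_pfst0] assms)
  moreover have "rec_nat 1 (\<lambda>k r. r * a) b = a ^ b" for a b :: nat
    by (induction b) simp_all
  ultimately show ?thesis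
    by simp
qed

lemma decidable_compose: "decidable P \<Longrightarrow> computable f \<Longrightarrow> decidable (\<lambda>x. P (f x))"
  unfolding decidable_def by (rule computable_compose)

lemma decidable_const: "decidable (\<lambda>x. b)"
  unfolding decidable_def by (rule computable_const)

lemma computable_if:
  assumes "decidable P" "computable f" "computable g"
  shows "computable (\<lambda>x. if P x then f x else g x)"
proof -
  \<comment> \<open>The truth value counts the iterations: none leaves \<open>g x\<close>, one
    replaces it by \<open>f x\<close>.\<close>
  have "computable (\<lambda>x. rec_nat (g x) (\<lambda>k r. f x) (of_bool (P x)))"
    using assms by (intro computable_rec_nat)
      (simp_all add: decidable_def computable_compose[of f, OF _ computable_pfst0])
  moreover have "rec_nat (g x) (\<lambda>k r. f x) (of_bool (P x)) = (if P x then f x else g x)" for x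
    by simp
  ultimately show ?thesis by simp
qed

lemma decidable_if:
  assumes "decidable P" "decidable Q" "decidable R"
  shows "decidable (\<lambda>x. if P x then Q x else R x)"
proof -
  have "(\<lambda>x. of_bool (if P x then Q x else R x) :: nat) =
      (\<lambda>x. if P x then of_bool (Q x) else of_bool (R x))"
    by auto
  then show ?thesis
    using computable_if assms unfolding decidable_def by presburger
qed

lemma decidable_not:
  assumes "decidable P"
  shows "decidable (\<lambda>x. \<not> P x)"
proof -
  have *: "(\<not> b) = (if b then False else True)" for b
    by simp
  show ?thesis
    unfolding * by (intro decidable_if decidable_const assms)
qed

lemma decidable_conj:
  assumes "decidable P" "decidable Q"
  shows "decidable (\<lambda>x. P x \<and> Q x)"
proof -
  have *: "(a \<and> b) = (if a then b else False)" for a b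
    by simp
  show ?thesis
    unfolding * by (intro decidable_if decidable_const assms)
qed

lemma decidable_disj:
  assumes "decidable P" "decidable Q"
  shows "decidable (\<lambda>x. P x \<or> Q x)"
proof -
  have *: "(a \<or> b) = (if a then True else b)" for a b
    by simp
  show ?thesis
    unfolding * by (intro decidable_if decidable_const assms)
qed

lemma decidable_imp:
  assumes "decidable P" "decidable Q"
  shows "decidable (\<lambda>x. P x \<longrightarrow> Q x)"
  unfolding imp_conv_disj by (intro decidable_disj decidable_not assms)

lemma decidable_iff:
  assumes "decidable P" "decidable Q"
  shows "decidable (\<lambda>x. P x \<longleftrightarrow> Q x)"
  unfolding iff_conv_conj_imp by (intro decidable_conj decidable_imp assms)

lemma decidable_le:
  assumes "computable f" "computable g"
  shows "decidable (\<lambda>x. f x \<le> g x)"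
proof -
  have "computable (\<lambda>x. 1 - (f x - g x))"
    by (intro computable_minus computable_const assms)
  moreover have "1 - (a - b) = of_bool (a \<le> b)" for a b :: nat
    by simp
  ultimately show ?thesis
    unfolding decidable_def by simp
qed

lemma decidable_less:
  assumes "computable f" "computable g"
  shows "decidable (\<lambda>x. f x < g x)"
  unfolding not_le[symmetric] by (intro decidable_not decidable_le assms)

lemma decidable_eq:
  assumes "computable f" "computable g"
  shows "decidable (\<lambda>x. f x = g x)"
  unfolding order_eq_iff by (intro decidable_conj decidable_le assms)

text \<open>
  The parameter \<open>x\<close> of a predicate stands for the tuple of all variables in scope; a quantifier
  pairs it with the bound variable.
\<close>

lemma decidable_ex_less:
  assumes P: "decidable (\<lambda>z. P (pfst z) (psnd z))" and b: "computable b"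
  shows "decidable (\<lambda>x. \<exists>y<b x. P x y)"
proof -
  have "rec_nat 0 (\<lambda>k r. if P x k then 1 else r) n = (of_bool (\<exists>y<n. P x y) :: nat)" for x n
    by (induction n) (auto simp: less_Suc_eq)
  moreover have "decidable (\<lambda>z. P (pfst z) (pfst (psnd z)))"
    using decidable_compose[OF P
        computable_pair[OF computable_pfst0 computable_pfst[OF computable_psnd0]]] by simp
  then have "computable (\<lambda>x. rec_nat 0 (\<lambda>k r. if P x k then 1 else r) (b x))"
    using b by (intro computable_rec_nat computable_if computable_const computable_psnd computable_id)
  ultimately show ?thesis
    unfolding decidable_def by simp
qed

lemma decidable_ex_le:
  assumes "decidable (\<lambda>z. P (pfst z) (psnd z))" "computable b"
  shows "decidable (\<lambda>x. \<exists>y\<le>b x. P x y)"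
  unfolding less_Suc_eq_le[symmetric] by (intro decidable_ex_less computable_Suc assms)

lemma decidable_all_less:
  assumes "decidable (\<lambda>z. P (pfst z) (psnd z))" "computable b"
  shows "decidable (\<lambda>x. \<forall>y<b x. P x y)"
proof -
  have "decidable (\<lambda>x. \<not> (\<exists>y<b x. \<not> P x y))"
    by (intro decidable_not decidable_ex_less assms)
  then show ?thesis
    by simp
qed

lemma decidable_all_le:
  assumes "decidable (\<lambda>z. P (pfst z) (psnd z))" "computable b"
  shows "decidable (\<lambda>x. \<forall>y\<le>b x. P x y)"
  unfolding less_Suc_eq_le[symmetric] by (intro decidable_all_less computable_Suc assms)

lemma computable_Least:
  assumes P: "decidable (\<lambda>z. P (pfst z) (psnd z))" and ex: "\<And>x. \<exists>n. P x n"
  shows "computable (\<lambda>x. LEAST n. P x n)"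
proof -
  \<comment> \<open>The truth value is negated because \<open>mu_search\<close> looks for a
    zero.\<close>
  let ?f = "\<lambda>z. Some (of_bool (\<not> P (pfst z) (psnd z)) :: nat)"
  have "partial_computable (mu_search ?f)"
    using decidable_not[OF P] unfolding decidable_def computable_def
    by (rule partial_computable.mu)
  moreover have "mu_search ?f = (\<lambda>x. Some (LEAST n. P x n))"
    using ex by (auto simp: mu_search_def)
  ultimately show ?thesis
    unfolding computable_def by simp
qed

section \<open>Coded finite sets and course-of-values recursion\<close>

lemma decidable_set_decode:
  "computable f \<Longrightarrow> computable g \<Longrightarrow> decidable (\<lambda>x. f x \<in> set_decode (g x))"
proof -
  \<comment> \<open>Bit \<open>a\<close> of \<open>b\<close> is set iff \<open>b div 2 ^ a\<close>
    is odd, say \<open>2 * j + 1\<close>; a bounded search for \<open>j\<close> replaces the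
    division.\<close>
  have *: "a \<in> set_decode b \<longleftrightarrow> (\<exists>j\<le>b. (2 * j + 1) * 2 ^ a \<le> b \<and> b < (2 * j + 2) * 2 ^ a)" for a b
  proof
    assume "a \<in> set_decode b"
    then have "odd (b div 2 ^ a)"
      by (simp add: set_decode_def)
    then obtain j where j: "b div 2 ^ a = 2 * j + 1"
      by (rule oddE)
    have "b div 2 ^ a * 2 ^ a \<le> b" "b < (b div 2 ^ a + 1) * 2 ^ a"
      using div_times_less_eq_dividend[of b "2 ^ a"] dividend_less_div_times[of "2 ^ a" b] by simp_all
    moreover have "j \<le> b"
      using j div_le_dividend[of b "2 ^ a"] by linarith
    ultimately show "\<exists>j\<le>b. (2 * j + 1) * 2 ^ a \<le> b \<and> b < (2 * j + 2) * 2 ^ a"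
      unfolding j by (intro exI[of _ j]) simp
  next
    assume "\<exists>j\<le>b. (2 * j + 1) * 2 ^ a \<le> b \<and> b < (2 * j + 2) * 2 ^ a"
    then obtain j where j: "(2 * j + 1) * 2 ^ a \<le> b" "b < (2 * j + 2) * 2 ^ a"
      by blast
    then have "b div 2 ^ a = 2 * j + 1"
      by (intro div_nat_eqI) (simp_all add: mult.commute)
    then show "a \<in> set_decode b"
      by (simp add: set_decode_def)
  qed
  show "computable f \<Longrightarrow> computable g \<Longrightarrow> ?thesis"
    unfolding * by (intro decidable_ex_le decidable_conj decidable_le decidable_less computable_mult
      computable_add computable_power computable_const computable_psnd computable_id
      computable_compose[of f, OF _ computable_pfst0] computable_compose[of g, OF _ computable_pfst0])
qed

lemma decidable_mem: "computable_set A \<Longrightarrow> computable f \<Longrightarrow> decidable (\<lambda>x. f x \<in> A)"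
  by (rule decidable_compose[of "\<lambda>x. x \<in> A"]) (auto simp: decidable_def computable_set_def of_bool_def)

lemma computable_set_Collect: "decidable P \<Longrightarrow> computable_set {x. P x}"
  unfolding computable_set_def decidable_def by (simp add: of_bool_def)

lemmas computable_intros =
  decidable_const decidable_if decidable_not decidable_conj decidable_disj decidable_imp decidable_iff
  decidable_le decidable_less decidable_eq
  decidable_ex_less decidable_ex_le decidable_all_less decidable_all_le
  decidable_set_decode decidable_mem
  computable_id computable_const computable_pfst computable_psnd computable_pair computable_Suc
  computable_add computable_power computable_mult computable_minus

text \<open>The finite set built so far is carried along a primitive recursion as one number. The
  partitions for infinite degree and for the locally finite case are obtained from this.\<close>

lemma course_of_values:
  assumes P: "decidable (\<lambda>z. P (pfst z) (set_decode (psnd z)))"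
  shows "\<exists>X. computable_set X \<and> (\<forall>n. n \<in> X \<longleftrightarrow> P n (X \<inter> {..<n}))"
proof -
  define c where "c = rec_nat 0 (\<lambda>k r. if P k (set_decode r) then 2 ^ k + r else r)"
  define X where "X = {n. P n (set_decode (c n))}"
  have c0: "c 0 = 0" and cS: "c (Suc n) = (if P n (set_decode (c n)) then 2 ^ n + c n else c n)" for n
    by (simp_all add: c_def)
  have c: "set_decode (c n) = X \<inter> {..<n}" for n
  proof (induction n)
    case (Suc n)
    \<comment> \<open>Bit \<open>n\<close> is still clear, so adding \<open>2 ^ n\<close> inserts
      \<open>n\<close>.\<close>
    then have "n \<notin> set_decode (c n)"
      by simp
    then have "set_decode (c (Suc n)) = (if n \<in> X then insert n (set_decode (c n)) else set_decode (c n))"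
      by (simp add: cS set_decode_plus_power_2 X_def)
    then show ?case
      unfolding Suc by (auto simp: less_Suc_eq)
  qed (simp add: c0)
  have P': "decidable (\<lambda>z. P (pfst (psnd z)) (set_decode (psnd (psnd z))))"
    using decidable_compose[OF P computable_psnd0] .
  have comp_c: "computable c"
  proof -
    have "computable (\<lambda>n. rec_nat 0 (\<lambda>k r. if P k (set_decode r) then 2 ^ k + r else r) n)"
      by (intro computable_rec_nat computable_if P' computable_intros)
    then show ?thesis
      unfolding c_def by simp
  qed
  have "decidable (\<lambda>n. P n (set_decode (c n)))"
    using decidable_compose[OF P computable_pair[OF computable_id comp_c]] by simp
  then have "computable_set X"
    unfolding X_def by (rule computable_set_Collect)
  moreover have "n \<in> X \<longleftrightarrow> P n (X \<inter> {..<n})" for n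
    unfolding c[symmetric] by (simp add: X_def)
  ultimately show ?thesis
    by blast
qed

lemma computable_set_iff: "computable_set A \<longleftrightarrow> decidable (\<lambda>x. x \<in> A)"
  unfolding computable_set_def decidable_def by (simp add: of_bool_def)

lemma computable_set_Diff: "computable_set A \<Longrightarrow> computable_set B \<Longrightarrow> computable_set (A - B)"
  unfolding computable_set_iff Diff_iff by (intro decidable_conj decidable_not)

lemma computable_set_Int: "computable_set A \<Longrightarrow> computable_set B \<Longrightarrow> computable_set (A \<inter> B)"
  unfolding computable_set_iff Int_iff by (intro decidable_conj)

lemma computable_set_Un: "computable_set A \<Longrightarrow> computable_set B \<Longrightarrow> computable_set (A \<union> B)"
  unfolding computable_set_iff Un_iff by (intro decidable_disj)

lemma computable_set_finite: "finite A \<Longrightarrow> computable_set A"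
proof (induction A rule: finite_induct)
  case empty
  show ?case
    unfolding computable_set_iff by (simp add: decidable_const)
next
  case (insert a A)
  then show ?case
    unfolding computable_set_iff insert_iff
    by (intro decidable_disj decidable_eq computable_id computable_const)
qed

lemma computable_set_finite_difference:
  assumes "computable_set B" "finite U" "A - U = B - U"
  shows "computable_set A"
proof -
  have "A = (B - U) \<union> (A \<inter> U)"
    using assms(3) by blast
  then show ?thesis
    using assms computable_set_Un computable_set_Diff computable_set_finite by (metis finite_Int)
qed

section \<open>A universal step predicate\<close>

text \<open>
  An index \<open>e\<close> is \<open>\<langle>k, \<langle>a, b\<rangle>\<rangle>\<close>, where \<open>k\<close> selects the clause of \<^const>\<open>partial_computable\<close> and \<open>a\<close>, \<open>b\<close>
  are the indices of its arguments.  \<open>justified D e x y\<close> says that ``\<open>e\<close> maps \<open>x\<close> to \<open>y\<close>'' follows by this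
  clause from the facts in \<open>D\<close>.  A computation is a finite set \<open>h\<close> of facts justified by the set
  itself; no order on the facts is needed, since the facts used have a smaller index or, in a primitive
  recursion, the same index and a smaller argument.
\<close>

definition justified :: "(nat \<Rightarrow> nat \<Rightarrow> nat \<Rightarrow> bool) \<Rightarrow> nat \<Rightarrow> nat \<Rightarrow> nat \<Rightarrow> bool" where
  "justified D e x y \<longleftrightarrow>
     pfst e = 0 \<and> y = 0 \<or>
     pfst e = 1 \<and> y = Suc x \<or>
     pfst e = 2 \<and> y = pfst x \<or>
     pfst e = 3 \<and> y = psnd x \<or>
     pfst e = 4 \<and> D (pfst (psnd e)) x (pfst y) \<and> D (psnd (psnd e)) x (psnd y) \<or>
     pfst e = 5 \<and> (\<exists>z. D (psnd (psnd e)) x z \<and> D (pfst (psnd e)) z y) \<or>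
     pfst e = 6 \<and>
       (if psnd x = 0 then D (pfst (psnd e)) (pfst x) y
        else \<exists>r. D e (prod_encode (pfst x, psnd x - 1)) r \<and>
               D (psnd (psnd e)) (prod_encode (pfst x, prod_encode (psnd x - 1, r))) y) \<or>
     7 \<le> pfst e \<and> D (pfst (psnd e)) (prod_encode (x, y)) 0 \<and>
       (\<forall>m<y. \<exists>z. D (pfst (psnd e)) (prod_encode (x, m)) (Suc z))"

definition fact_in :: "nat \<Rightarrow> nat \<Rightarrow> nat \<Rightarrow> nat \<Rightarrow> bool" where
  "fact_in h e x y \<longleftrightarrow> prod_encode (e, prod_encode (x, y)) \<in> set_decode h"

definition valid :: "nat \<Rightarrow> bool" where
  "valid h \<longleftrightarrow> (\<forall>e x y. fact_in h e x y \<longrightarrow> justified (fact_in h) e x y)"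

definition derivable :: "nat \<Rightarrow> nat \<Rightarrow> nat \<Rightarrow> bool" where
  "derivable e x y \<longleftrightarrow> (\<exists>h. valid h \<and> fact_in h e x y)"

text \<open>The stage \<open>t\<close> bounds the code of the computation, which makes the relation
  decidable and monotone in \<open>t\<close>.\<close>

definition step :: "nat \<Rightarrow> nat \<Rightarrow> nat \<Rightarrow> nat \<Rightarrow> bool" where
  "step e t x y \<longleftrightarrow> (\<exists>h<t. valid h \<and> fact_in h e x y)"

definition represents :: "nat \<Rightarrow> (nat \<Rightarrow> nat option) \<Rightarrow> bool" where
  "represents e f \<longleftrightarrow> (\<forall>x y. derivable e x y \<longleftrightarrow> f x = Some y)"

text \<open>An element \<open>n\<close> of the set coded by \<open>h\<close> satisfies
  \<open>2 ^ n \<le> h\<close>, hence \<open>n < h\<close>, and a pair is at least as large as its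
  components.\<close>

lemma fact_in_bound:
  assumes "fact_in h e x y"
  shows "e < h" "x < h" "y < h"
proof -
  let ?n = "prod_encode (e, prod_encode (x, y))"
  have "odd (h div 2 ^ ?n)"
    using assms by (simp add: fact_in_def set_decode_def)
  then have "h div 2 ^ ?n \<noteq> 0"
    by (metis even_zero)
  then have "2 ^ ?n \<le> h"
    by (simp add: div_eq_0_iff)
  then have "?n < h"
    by (rule less_le_trans[OF less_exp])
  then show "e < h" "x < h" "y < h"
    using le_prod_encode_1[of e "prod_encode (x, y)"] le_prod_encode_2[of "prod_encode (x, y)" e]
      le_prod_encode_1[of x y] le_prod_encode_2[of y x] by simp_all
qed

lemma decidable_fact_in:
  assumes "computable h" "computable e" "computable x" "computable y"
  shows "decidable (\<lambda>z. fact_in (h z) (e z) (x z) (y z))"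
  unfolding fact_in_def by (intro computable_intros assms)

lemma decidable_valid:
  assumes "computable h"
  shows "decidable (\<lambda>z. valid (h z))"
proof -
  \<comment> \<open>Facts in \<open>h\<close> have components below \<open>h\<close>, so the
    unbounded quantifiers in \<open>valid\<close> become bounded.\<close>
  have ex1: "(\<exists>z. fact_in h e x z \<and> Q z) \<longleftrightarrow> (\<exists>z<h. fact_in h e x z \<and> Q z)" for h e x Q
    using fact_in_bound by blast
  have ex2: "(\<exists>z. fact_in h e x (Suc z)) \<longleftrightarrow> (\<exists>z<h. fact_in h e x (Suc z))" for h e x
    using fact_in_bound(3) Suc_lessD by blast
  have all: "(\<forall>e x y. fact_in h e x y \<longrightarrow> Q e x y) \<longleftrightarrow>
      (\<forall>e<h. \<forall>x<h. \<forall>y<h. fact_in h e x y \<longrightarrow> Q e x y)" for h Q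
    using fact_in_bound by blast
  have "decidable (\<lambda>h. valid h)"
    unfolding valid_def justified_def ex1 ex2 all
    by (intro computable_intros decidable_fact_in)
  from decidable_compose[OF this assms] show ?thesis .
qed

lemma decidable_step:
  assumes "computable e" "computable t" "computable x" "computable y"
  shows "decidable (\<lambda>z. step (e z) (t z) (x z) (y z))"
proof -
  have "decidable (\<lambda>z. step (pfst z) (pfst (psnd z)) (pfst (psnd (psnd z))) (psnd (psnd (psnd z))))"
    unfolding step_def by (intro computable_intros decidable_fact_in decidable_valid)
  from decidable_compose[OF this computable_pair[OF assms(1)
      computable_pair[OF assms(2) computable_pair[OF assms(3,4)]]]]
  show ?thesis by simp
qed

text \<open>\<open>D\<close> occurs only positively in \<open>justified\<close>.\<close>

lemma justified_mono:
  assumes "justified D e x y" "\<And>e x y. D e x y \<Longrightarrow> D' e x y"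
  shows "justified D' e x y"
proof -
  have "\<forall>e x y. D e x y \<longrightarrow> D' e x y"
    using assms(2) by blast
  then show ?thesis
    using assms(1) unfolding justified_def by (elim disjE conjE) (simp_all split: if_splits, blast+)
qed

text \<open>Each clause uses finitely many facts; for the search clause these are the zero at
  \<open>y\<close> and one positive value for every \<open>m < y\<close>.\<close>

lemma justified_finite:
  assumes "justified D e x y"
  shows "\<exists>S. finite S \<and> (\<forall>(e, x, y)\<in>S. D e x y) \<and> justified (\<lambda>e x y. (e, x, y) \<in> S) e x y"
proof -
  let ?a = "pfst (psnd e)" and ?b = "psnd (psnd e)"
  consider (basic) "pfst e < 4" "pfst e = 0 \<and> y = 0 \<or>  pfst e = 1 \<and> y = Suc x \<or>
     pfst e = 2 \<and> y = pfst x \<or>  pfst e = 3 \<and> y = psnd x"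
   | (pair) "pfst e = 4" "D ?a x (pfst y)" "D ?b x (psnd y)"
   | (comp) z where "pfst e = 5" "D ?b x z" "D ?a z y"
   | (rec0) "pfst e = 6" "psnd x = 0" "D ?a (pfst x) y"
   | (recS) r where "pfst e = 6" "psnd x \<noteq> 0" "D e (prod_encode (pfst x, psnd x - 1)) r"
        "D ?b (prod_encode (pfst x, prod_encode (psnd x - 1, r))) y"
   | (mu) "7 \<le> pfst e" "D ?a (prod_encode (x, y)) 0"
       "\<forall>m<y. \<exists>z. D ?a (prod_encode (x, m)) (Suc z)"
    using assms unfolding justified_def by (elim disjE conjE) (simp_all split: if_splits, blast+)
  then show ?thesis
  proof cases
    case basic
    then show ?thesis
      by (intro exI[of _ "{}"]) (auto simp: justified_def)
  next
    case pair
    then show ?thesis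
      by (intro exI[of _ "{(?a, x, pfst y), (?b, x, psnd y)}"]) (simp add: justified_def)
  next
    case comp
    then show ?thesis
      by (intro exI[of _ "{(?b, x, z), (?a, z, y)}"]) (auto simp add: justified_def)
  next
    case rec0
    then show ?thesis
      by (intro exI[of _ "{(?a, pfst x, y)}"]) (simp add: justified_def)
  next
    case recS
    then show ?thesis
      by (intro exI[of _ "{(e, prod_encode (pfst x, psnd x - 1), r),
        (?b, prod_encode (pfst x, prod_encode (psnd x - 1, r)), y)}"]) (auto simp add: justified_def)
  next
    case mu
    then obtain f where "\<forall>m<y. D ?a (prod_encode (x, m)) (Suc (f m))"
      by metis
    with mu show ?thesis
      by (intro exI[of _ "insert (?a, prod_encode (x, y), 0)
        ((\<lambda>m. (?a, prod_encode (x, m), Suc (f m))) ` {..<y})"]) (auto simp add: justified_def)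
  qed
qed

lemma valid_union:
  assumes "valid h" "valid h'"
  shows "valid (set_encode (set_decode h \<union> set_decode h'))"
proof -
  let ?u = "set_encode (set_decode h \<union> set_decode h')"
  have u: "fact_in ?u e x y \<longleftrightarrow> fact_in h e x y \<or> fact_in h' e x y" for e x y
    by (simp add: fact_in_def set_encode_inverse)
  show ?thesis
    unfolding valid_def
  proof (intro allI impI)
    fix e x y
    assume "fact_in ?u e x y"
    then have "justified (fact_in h) e x y \<or> justified (fact_in h') e x y"
      using assms u unfolding valid_def by blast
    then show "justified (fact_in ?u) e x y"
      using u by (blast intro: justified_mono)
  qed
qed

text \<open>Computations can be merged, since a union of valid sets is valid.\<close>

lemma valid_finite:
  assumes "finite S" "\<forall>(e, x, y)\<in>S. derivable e x y"
  shows "\<exists>h. valid h \<and> (\<forall>(e, x, y)\<in>S. fact_in h e x y)"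
  using assms
proof (induction S)
  case empty
  have "valid 0"
    by (simp add: valid_def fact_in_def)
  then show ?case by auto
next
  case (insert p S)
  obtain e x y where p: "p = (e, x, y)"
    by (cases p)
  obtain h h' where "valid h" "\<forall>(e, x, y)\<in>S. fact_in h e x y" "valid h'" "fact_in h' e x y"
    using insert p by (auto simp: derivable_def)
  then show ?case
    using p by (intro exI[of _ "set_encode (set_decode h \<union> set_decode h')"])
      (auto simp: valid_union fact_in_def set_encode_inverse)
qed

text \<open>From right to left: only finitely many premises are used, so they lie in one
  computation, and the new fact can be added to it.\<close>

lemma derivable_iff: "derivable e x y \<longleftrightarrow> justified derivable e x y"
proof
  assume "derivable e x y"
  then obtain h where "valid h" "fact_in h e x y"
    by (auto simp: derivable_def)
  then show "justified derivable e x y"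
    unfolding valid_def by (metis (no_types, lifting) derivable_def justified_mono valid_def)
next
  assume "justified derivable e x y"
  from justified_finite[OF this] obtain S where S: "finite S" "\<forall>(e, x, y)\<in>S. derivable e x y"
    "justified (\<lambda>e x y. (e, x, y) \<in> S) e x y"
    by blast
  obtain h where h: "valid h" "\<forall>(e, x, y)\<in>S. fact_in h e x y"
    using valid_finite[OF S(1,2)] by blast
  define h' where "h' = set_encode (insert (prod_encode (e, prod_encode (x, y))) (set_decode h))"
  have h': "fact_in h' e' x' y' \<longleftrightarrow> (e', x', y') = (e, x, y) \<or> fact_in h e' x' y'" for e' x' y'
    by (auto simp: fact_in_def h'_def set_encode_inverse)
  have "justified (fact_in h') e x y"
    using S(3) by (rule justified_mono) (use h(2) h' in blast)
  moreover have "justified (fact_in h') e' x' y'" if "fact_in h e' x' y'" for e' x' y'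
    using h(1) that h' unfolding valid_def by (metis justified_mono)
  ultimately have "valid h'"
    unfolding valid_def using h' by auto
  then show "derivable e x y"
    using h' by (auto simp: derivable_def)
qed

section \<open>Correspondence between indices and partial computable functions\<close>

lemma represents_basic:
  "pfst e = 0 \<Longrightarrow> represents e (\<lambda>n. Some 0)"
  "pfst e = 1 \<Longrightarrow> represents e (\<lambda>n. Some (Suc n))"
  "pfst e = 2 \<Longrightarrow> represents e (\<lambda>n. Some (pfst n))"
  "pfst e = 3 \<Longrightarrow> represents e (\<lambda>n. Some (psnd n))"
  unfolding represents_def by (auto simp: derivable_iff[of e] justified_def)

lemma represents_pair:
  assumes "pfst e = 4" "represents (pfst (psnd e)) f" "represents (psnd (psnd e)) g"
  shows "represents e
    (\<lambda>n. Option.bind (f n) (\<lambda>x. Option.bind (g n) (\<lambda>y. Some (prod_encode (x, y)))))"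
  using assms unfolding represents_def
  by (auto simp: derivable_iff[of e] justified_def bind_eq_Some_conv)

lemma represents_comp:
  assumes "pfst e = 5" "represents (pfst (psnd e)) f" "represents (psnd (psnd e)) g"
  shows "represents e (\<lambda>n. Option.bind (g n) f)"
  using assms unfolding represents_def
  by (auto simp: derivable_iff[of e] justified_def bind_eq_Some_conv)

lemma represents_prim_rec:
  assumes "pfst e = 6" "represents (pfst (psnd e)) f" "represents (psnd (psnd e)) g"
  shows "represents e (\<lambda>n. prim_rec f g (pfst n) (psnd n))"
proof -
  \<comment> \<open>The clause refers to \<open>e\<close> itself at the previous argument, hence an
    induction on \<open>k\<close>.\<close>
  have rec: "derivable e (prod_encode (a, k)) y \<longleftrightarrow> prim_rec f g a k = Some y" for a k y
    using assms unfolding represents_def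
    by (induction k arbitrary: y)
      (auto simp: derivable_iff[of e "prod_encode (a, _)"] justified_def bind_eq_Some_conv)
  show ?thesis
    unfolding represents_def using rec[of "pfst x" "psnd x" for x] by simp
qed

lemma represents_mu:
  assumes "7 \<le> pfst e" "represents (pfst (psnd e)) f"
  shows "represents e (mu_search f)"
  unfolding represents_def
proof (intro allI)
  fix x y
  \<comment> \<open>\<open>Suc z\<close> says at once that the value at \<open>m\<close> is defined
    and nonzero, so \<open>y\<close> is the first zero.\<close>
  have "derivable e x y \<longleftrightarrow> f (prod_encode (x, y)) = Some 0 \<and>
      (\<forall>m<y. \<exists>z. f (prod_encode (x, m)) = Some (Suc z))" (is "_ \<longleftrightarrow> ?R")
    using assms unfolding represents_def by (auto simp: derivable_iff[of e] justified_def)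
  also have "\<dots> \<longleftrightarrow> mu_search f x = Some y"
  proof
    assume R: ?R
    have "(LEAST n. f (prod_encode (x, n)) = Some 0) = y"
    proof (rule Least_equality)
      show "f (prod_encode (x, y)) = Some 0"
        using R by blast
      show "y \<le> n" if "f (prod_encode (x, n)) = Some 0" for n
      proof (rule ccontr)
        assume "\<not> y \<le> n"
        then obtain z where "f (prod_encode (x, n)) = Some (Suc z)"
          using R by (meson not_le)
        with that show False
          by simp
      qed
    qed
    moreover have "\<forall>m<y. f (prod_encode (x, m)) \<noteq> None"
      using R by fastforce
    ultimately show "mu_search f x = Some y"
      using R unfolding mu_search_def by (metis (mono_tags, lifting))
  next
    assume mu: "mu_search f x = Some y"
    then obtain n where n: "f (prod_encode (x, n)) = Some 0" "\<forall>m<n. f (prod_encode (x, m)) \<noteq> None"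
      and y: "y = (LEAST n. f (prod_encode (x, n)) = Some 0)"
      unfolding mu_search_def by (metis (mono_tags, lifting) option.distinct(1) option.inject)
    have y0: "f (prod_encode (x, y)) = Some 0"
      unfolding y using n(1) by (rule LeastI)
    have "y \<le> n"
      unfolding y using n(1) by (rule Least_le)
    have "\<exists>z. f (prod_encode (x, m)) = Some (Suc z)" if "m < y" for m
    proof -
      have "f (prod_encode (x, m)) \<noteq> Some 0"
        using that not_less_Least unfolding y by blast
      moreover have "f (prod_encode (x, m)) \<noteq> None"
        using n(2) that \<open>y \<le> n\<close> by simp
      ultimately show ?thesis
        by (metis not0_implies_Suc option.exhaust)
    qed
    with y0 show ?R
      by blast
  qed
  finally show "derivable e x y \<longleftrightarrow> mu_search f x = Some y" .
qed

lemma partial_computable_represents: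
  assumes "partial_computable f"
  shows "\<exists>e. represents e f"
  using assms
proof induction
  case zero
  show ?case by (rule exI, rule represents_basic(1)[of "prod_encode (0, 0)"]) simp
next
  case succ
  show ?case by (rule exI, rule represents_basic(2)[of "prod_encode (1, 0)"]) simp
next
  case left
  show ?case by (rule exI, rule represents_basic(3)[of "prod_encode (2, 0)"]) simp
next
  case right
  show ?case by (rule exI, rule represents_basic(4)[of "prod_encode (3, 0)"]) simp
next
  case (pair f g)
  then obtain a b where "represents a f" "represents b g"
    by blast
  then show ?case
    by (intro exI[of _ "prod_encode (4, prod_encode (a, b))"] represents_pair) simp_all
next
  case (comp f g)
  then obtain a b where "represents a f" "represents b g"
    by blast
  then show ?case
    by (intro exI[of _ "prod_encode (5, prod_encode (a, b))"] represents_comp) simp_all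
next
  case (prec f g)
  then obtain a b where "represents a f" "represents b g"
    by blast
  then show ?case
    by (intro exI[of _ "prod_encode (6, prod_encode (a, b))"] represents_prim_rec) simp_all
next
  case (mu f)
  then obtain a where "represents a f"
    by blast
  then show ?case
    by (intro exI[of _ "prod_encode (7, prod_encode (a, 0))"] represents_mu) simp_all
qed

text \<open>Induction on \<open>e\<close>, as the indices of the arguments are smaller. This yields
  uniqueness of outputs for arbitrary indices in \<open>step_unique\<close>.\<close>

lemma represents_ex: "\<exists>f. represents e f"
proof (induction e rule: less_induct)
  case (less e)
  show ?case
  proof (cases "pfst e < 4")
    case True
    then have "pfst e = 0 \<or> pfst e = 1 \<or> pfst e = 2 \<or> pfst e = 3"
      by linarith
    then show ?thesis
      using represents_basic[of e] by blast
  next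
    case False
    \<comment> \<open>The clause number is positive here, which makes \<open>psnd e < e\<close>
      strict; compare \<open>prod_encode (0, 1) = 1\<close>.\<close>
    have encode: "prod_encode (m, n) = triangle (m + n) + m" for m n
      by (simp add: prod_encode_def)
    have "pfst e + psnd e \<le> triangle (pfst e + psnd e)"
      using le_prod_encode_2[of "pfst e + psnd e" 0] encode[of 0] by simp
    moreover have "e = triangle (pfst e + psnd e) + pfst e"
      using encode[of "pfst e" "psnd e"] by simp
    ultimately have "psnd e < e"
      using False by simp
    moreover have "pfst (psnd e) \<le> psnd e" "psnd (psnd e) \<le> psnd e"
      using le_prod_encode_1[of "pfst (psnd e)" "psnd (psnd e)"]
        le_prod_encode_2[of "psnd (psnd e)" "pfst (psnd e)"] by simp_all
    ultimately have "pfst (psnd e) < e" "psnd (psnd e) < e"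
      by simp_all
    then obtain f g where "represents (pfst (psnd e)) f" "represents (psnd (psnd e)) g"
      using less by blast
    moreover have "pfst e = 4 \<or> pfst e = 5 \<or> pfst e = 6 \<or> 7 \<le> pfst e"
      using False by linarith
    ultimately show ?thesis
      using represents_pair[of e f g] represents_comp[of e f g] represents_prim_rec[of e f g]
        represents_mu[of e f] by blast
  qed
qed

lemma derivable_iff_step: "derivable e x y \<longleftrightarrow> (\<exists>t. step e t x y)"
  unfolding derivable_def step_def by blast

lemma step_mono: "step e t x y \<Longrightarrow> t \<le> t' \<Longrightarrow> step e t' x y"
  unfolding step_def by (meson less_le_trans)

lemma step_unique: "step e t x y \<Longrightarrow> step e t' x y' \<Longrightarrow> y = y'"
proof -
  obtain f where "represents e f"
    using represents_ex by blast
  then have f: "step e t x y \<Longrightarrow> f x = Some y" for t x y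
    unfolding represents_def derivable_iff_step by blast
  show "step e t x y \<Longrightarrow> step e t' x y' \<Longrightarrow> y = y'"
    using f[of t x y] f[of t' x y'] by simp
qed

lemma partial_computable_step:
  assumes "partial_computable f"
  obtains e where "\<And>x y. f x = Some y \<longleftrightarrow> (\<exists>t. step e t x y)"
proof -
  obtain e where "represents e f"
    using partial_computable_represents[OF assms] by blast
  then have "f x = Some y \<longleftrightarrow> (\<exists>t. step e t x y)" for x y
    unfolding represents_def derivable_iff_step by simp
  then show thesis
    by (rule that)
qed

section \<open>Criteria for non-isomorphism\<close>

locale computable_graph_on_nat =
  fixes G :: graph
  assumes computable_graph: "computable_graph G"
begin

lemma verts_computable: "computable_set (verts G)"
  using computable_graph by (simp add: computable_graph_def)

lemma edge_sym: "(x, y) \<in> edges G \<Longrightarrow> (y, x) \<in> edges G"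
  using computable_graph by (auto simp: computable_graph_def is_graph_def dest: symD)

lemma edge_verts: "(x, y) \<in> edges G \<Longrightarrow> x \<in> verts G \<and> y \<in> verts G"
  using computable_graph by (auto simp: computable_graph_def is_graph_def)

lemma neighbours_eq: "neighbours G v = {y. (v, y) \<in> edges G}"
  using edge_verts by (auto simp: neighbours_def)

lemma decidable_edge:
  assumes "computable f" "computable g"
  shows "decidable (\<lambda>z. (f z, g z) \<in> edges G)"
proof -
  have "prod_encode (x, y) \<in> prod_encode ` edges G \<longleftrightarrow> (x, y) \<in> edges G" for x y
    by (auto simp: inj_on_def dest: inj_onD[OF inj_prod_encode])
  moreover have "decidable (\<lambda>z. prod_encode (f z, g z) \<in> prod_encode ` edges G)"
    using computable_graph by (intro decidable_mem computable_pair assms)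
      (simp add: computable_graph_def computable_rel_def)
  ultimately show ?thesis
    by simp
qed

lemma induced_iso_preimage:
  assumes "graph_iso f (induced_subgraph G X) G" "v \<in> verts G"
  shows "\<exists>x\<in>X. f x = v"
proof -
  have "f ` X = verts G"
    using assms(1) by (simp add: graph_iso_def induced_subgraph_def bij_betw_def)
  then have "v \<in> f ` X"
    using assms(2) by simp
  then show ?thesis
    by blast
qed

lemma induced_iso_edge:
  "graph_iso f (induced_subgraph G X) G \<Longrightarrow> x \<in> X \<Longrightarrow> y \<in> X \<Longrightarrow>
    (x, y) \<in> edges G \<longleftrightarrow> (f x, f y) \<in> edges G"
  by (simp add: graph_iso_def induced_subgraph_def)

text \<open>The preimage of \<open>v\<close> has a neighbour in \<open>X\<close>, whose image would
  be a neighbour of the isolated \<open>v\<close>.\<close>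

lemma not_iso_if_no_isolated:
  assumes "isolated G v" "\<And>x. x \<in> X \<Longrightarrow> \<exists>y\<in>X. (x, y) \<in> edges G"
  shows "\<not> graph_iso f (induced_subgraph G X) G"
proof
  assume iso: "graph_iso f (induced_subgraph G X) G"
  then obtain x where x: "x \<in> X" "f x = v"
    using assms(1) induced_iso_preimage isolated_def by blast
  then obtain y where "y \<in> X" "(x, y) \<in> edges G"
    using assms(2) by blast
  then have "(v, f y) \<in> edges G"
    using induced_iso_edge[OF iso] x by blast
  then show False
    using assms(1) by (auto simp: isolated_def neighbours_eq)
qed

text \<open>All neighbours of \<open>u\<close> are images of the finitely many neighbours in
  \<open>X\<close> of the preimage of \<open>u\<close>.\<close>

lemma not_iso_if_locally_finite:
  assumes "u \<in> verts G" "infinite (neighbours G u)"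
    and "\<And>x. x \<in> X \<Longrightarrow> finite {y \<in> X. (x, y) \<in> edges G}"
  shows "\<not> graph_iso f (induced_subgraph G X) G"
proof
  assume iso: "graph_iso f (induced_subgraph G X) G"
  then obtain x where x: "x \<in> X" "f x = u"
    using assms(1) induced_iso_preimage by blast
  have "neighbours G u \<subseteq> f ` {y \<in> X. (x, y) \<in> edges G}"
  proof
    fix z
    assume z: "z \<in> neighbours G u"
    then have "z \<in> verts G"
      by (simp add: neighbours_def)
    then obtain y where y: "y \<in> X" "f y = z"
      using induced_iso_preimage[OF iso] by blast
    with z x have "(x, y) \<in> edges G"
      using induced_iso_edge[OF iso] by (simp add: neighbours_eq)
    with y show "z \<in> f ` {y \<in> X. (x, y) \<in> edges G}"
      by auto
  qed
  then show False
    using assms(2,3) x(1) finite_subset by blast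
qed

lemma not_iso_if_edgeless:
  assumes "(a, b) \<in> edges G" "\<And>x y. x \<in> X \<Longrightarrow> y \<in> X \<Longrightarrow> (x, y) \<notin> edges G"
  shows "\<not> graph_iso f (induced_subgraph G X) G"
proof
  assume iso: "graph_iso f (induced_subgraph G X) G"
  have "a \<in> verts G" "b \<in> verts G"
    using edge_verts assms(1) by auto
  then obtain x y where "x \<in> X" "f x = a" "y \<in> X" "f y = b"
    using induced_iso_preimage[OF iso] by meson
  then show False
    using induced_iso_edge[OF iso] assms by blast
qed

lemma not_iso_if_finite:
  assumes "finite (verts G)" "X \<subset> verts G"
  shows "\<not> graph_iso f (induced_subgraph G X) G"
proof
  assume "graph_iso f (induced_subgraph G X) G"
  then have "card X = card (verts G)"
    unfolding graph_iso_def induced_subgraph_def using bij_betw_same_card by auto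
  then show False
    using psubset_card_mono[OF assms] by simp
qed

section \<open>A vertex of infinite degree\<close>

lemma infinite_degree_partition:
  assumes "isolated G v" "u \<in> verts G" "infinite (neighbours G u)"
    and ce: "comp_enumerable (finite_degree_verts G)"
  shows "\<exists>X0 X1. computable_partition (verts G) X0 X1 \<and>
           \<not> computably_isomorphic (induced_subgraph G X0) G \<and>
           \<not> computably_isomorphic (induced_subgraph G X1) G"
proof -
  obtain p where p: "partial_computable p" "finite_degree_verts G = dom p"
    using ce by (auto simp: comp_enumerable_def)
  obtain e where e: "\<And>x y. p x = Some y \<longleftrightarrow> (\<exists>t. step e t x y)"
    using partial_computable_step[OF p(1)] by blast
  define seen where "seen x t \<longleftrightarrow> (\<exists>y<t. step e t x y)" for x t
  have seen: "x \<in> finite_degree_verts G \<longleftrightarrow> (\<exists>t. seen x t)" for x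
  proof -
    have "\<exists>t. seen x t" if "step e t x y" for t y
      unfolding seen_def
      by (intro exI[of _ "Suc (max t y)"] exI[of _ y]) (auto intro: step_mono[OF that])
    then show ?thesis
      unfolding p(2) dom_def using e seen_def by (auto simp: not_None_eq)
  qed
  \<comment> \<open>An event ends the wait for \<open>x\<close>. A neighbour is reported as
    \<open>t\<close> itself, so the least event can later serve as the neighbour; non-vertices end
    the wait at once, which keeps the search total.\<close>
  define event where "event x t \<longleftrightarrow> x \<notin> verts G \<or> seen x t \<or> x < t \<and> (x, t) \<in> edges G" for x t
  have event: "\<exists>t. event x t" for x
  proof (rule ccontr)
    assume *: "\<nexists>t. event x t"
    then have "x \<in> verts G" "x \<notin> finite_degree_verts G"
      unfolding event_def seen by auto
    then have "infinite {y. (x, y) \<in> edges G}"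
      by (simp add: finite_degree_verts_def neighbours_eq)
    then obtain y where "x < y" "(x, y) \<in> edges G"
      unfolding infinite_nat_iff_unbounded by auto
    with * show False
      unfolding event_def by blast
  qed
  define Q where "Q x \<longleftrightarrow> \<not> seen x (LEAST t. event x t)" for x
  have dec_event: "decidable (\<lambda>z. event (pfst z) (psnd z))"
    unfolding event_def seen_def
    by (intro computable_intros decidable_step decidable_edge verts_computable)
  have "computable (\<lambda>x. LEAST t. event x t)"
    by (rule computable_Least[OF dec_event event])
  then have dec_Q: "decidable Q"
    unfolding Q_def seen_def
    by (intro computable_intros decidable_step)
     (use computable_compose[OF _ computable_pfst0] in blast)+
  have "decidable (\<lambda>z. pfst z \<in> verts G \<and>
      ((\<exists>y<pfst z. y \<in> set_decode (psnd z) \<and> (y, pfst z) \<in> edges G) \<or> Q (pfst z)))"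
    by (intro computable_intros decidable_edge verts_computable decidable_compose[OF dec_Q])
  from course_of_values[OF this] obtain X where X: "computable_set X"
    "\<forall>n. n \<in> X \<longleftrightarrow> n \<in> verts G \<and> ((\<exists>y<n. y \<in> X \<inter> {..<n} \<and> (y, n) \<in> edges G) \<or> Q n)"
    by blast
  have no_isolated: "\<exists>y\<in>X. (x, y) \<in> edges G" if x: "x \<in> X" for x
  proof (cases "\<exists>y<x. y \<in> X \<inter> {..<x} \<and> (y, x) \<in> edges G")
    case True
    then show ?thesis
      using edge_sym by auto
  next
    case False
    let ?t = "LEAST t. event x t"
    have "Q x" "x \<in> verts G"
      using X(2)[rule_format, of x] x False by auto
    moreover have "event x ?t"
      using event by (rule LeastI_ex)
    \<comment> \<open>\<open>Q x\<close> rules out enumeration, so the least event is a larger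
      neighbour; being adjacent to \<open>x\<close> in \<open>X\<close>, it enters \<open>X\<close>
      when its turn comes.\<close>
    ultimately have t: "x < ?t" "(x, ?t) \<in> edges G"
      unfolding event_def Q_def by auto
    then have "?t \<in> X"
      unfolding X(2)[rule_format, of ?t] using x edge_verts by auto
    with t show ?thesis
      by blast
  qed
  have "finite {y \<in> verts G - X. (x, y) \<in> edges G}" if "x \<in> verts G - X" for x
  proof -
    \<comment> \<open>A vertex left out has ended its wait by being enumerated, hence has finite
      degree.\<close>
    have "\<not> Q x"
      using X(2)[rule_format, of x] that by auto
    then have "x \<in> finite_degree_verts G"
      unfolding seen Q_def by blast
    then have "finite {y. (x, y) \<in> edges G}"
      by (simp add: finite_degree_verts_def neighbours_eq)
    then show ?thesis
      by (rule rev_finite_subset) auto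
  qed
  then have "\<not> computably_isomorphic (induced_subgraph G (verts G - X)) G"
    using not_iso_if_locally_finite[OF assms(2,3)] unfolding computably_isomorphic_def by blast
  moreover have "\<not> computably_isomorphic (induced_subgraph G X) G"
    using not_iso_if_no_isolated[OF assms(1) no_isolated] unfolding computably_isomorphic_def by blast
  moreover have "computable_partition (verts G) X (verts G - X)"
    using X computable_set_Diff[OF verts_computable X(1)] unfolding computable_partition_def by blast
  ultimately show ?thesis
    by blast
qed

section \<open>The locally finite case\<close>

text \<open>
  A requirement \<open>r = \<langle>e, p\<rangle>\<close> concerns the \<open>e\<close>-th partial computable function and the part of the
  vertices that lie in \<open>S\<close> (if \<open>p = 0\<close>) or outside \<open>S\<close> (otherwise).  Smaller \<open>r\<close> have priority.  Only
  \<open>S \<inter> {..<t}\<close> matters at stage \<open>t\<close>.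
\<close>

definition touched :: "nat \<Rightarrow> nat \<Rightarrow> bool" where
  "touched u t \<longleftrightarrow> (\<exists>y<t. (u, y) \<in> edges G)"

definition touched_in :: "nat set \<Rightarrow> nat \<Rightarrow> nat \<Rightarrow> nat \<Rightarrow> bool" where
  "touched_in S r w t \<longleftrightarrow> (\<exists>y<t. (w, y) \<in> edges G \<and> (y \<in> S \<longleftrightarrow> psnd r = 0))"

text \<open>The last clause keeps \<open>w\<close> apart from the values found so far at smaller
  vertices; this makes the map \<open>W\<close> in \<open>finite_frozen\<close> injective.\<close>

definition agree :: "nat set \<Rightarrow> nat \<Rightarrow> nat \<Rightarrow> nat \<Rightarrow> bool" where
  "agree S r u t \<longleftrightarrow>
     (\<exists>w<t. step (pfst r) t u w \<and> (w \<in> S \<longleftrightarrow> psnd r = 0) \<and>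
        (touched u t \<longleftrightarrow> touched_in S r w t) \<and>
        (\<forall>u'<u. u' \<in> verts G \<longrightarrow> \<not> step (pfst r) t u' w))"

text \<open>Once a vertex is frozen it remains so, even if the agreement below \<open>u\<close> is lost later.\<close>

definition frozen :: "nat set \<Rightarrow> nat \<Rightarrow> nat \<Rightarrow> nat \<Rightarrow> bool" where
  "frozen S r w s \<longleftrightarrow>
     (\<exists>t\<le>s. r \<le> t \<and> w < t \<and> (w \<in> S \<longleftrightarrow> psnd r = 0) \<and>
        (\<exists>u<t. u \<in> verts G \<and> step (pfst r) t u w \<and>
           (\<forall>u'<u. u' \<in> verts G \<longrightarrow> agree S r u' t)))"

definition claims :: "nat set \<Rightarrow> nat \<Rightarrow> nat \<Rightarrow> bool" where
  "claims S r n \<longleftrightarrow> (\<exists>w<n. frozen S r w n \<and> (w, n) \<in> edges G)"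

text \<open>The strongest requirement claiming \<open>n\<close> sends it to the part opposite its
  own; unclaimed numbers stay outside \<open>S\<close>. The bound \<open>r \<le> n\<close> misses no
  claim, as freezing by stage \<open>n\<close> demands it.\<close>

definition chosen :: "nat set \<Rightarrow> nat \<Rightarrow> bool" where
  "chosen S n \<longleftrightarrow> (\<exists>r\<le>n. psnd r \<noteq> 0 \<and> claims S r n \<and> (\<forall>r'<r. \<not> claims S r' n))"

lemma frozenI:
  assumes "t \<le> s" "r \<le> t" "w < t" "w \<in> S \<longleftrightarrow> psnd r = 0" "u < t" "u \<in> verts G"
    and "step (pfst r) t u w" "\<And>u'. u' < u \<Longrightarrow> u' \<in> verts G \<Longrightarrow> agree S r u' t"
  shows "frozen S r w s"
proof -
  have *: "\<exists>u<t. u \<in> verts G \<and> step (pfst r) t u w \<and> (\<forall>u'<u. u' \<in> verts G \<longrightarrow> agree S r u' t)"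
    using assms(5-8) by blast
  show ?thesis
    unfolding frozen_def by (rule exI[of _ t]) (simp add: assms(1-4) *)
qed

lemma touched_in_local: "t \<le> n \<Longrightarrow> touched_in (S \<inter> {..<n}) r w t \<longleftrightarrow> touched_in S r w t"
  unfolding touched_in_def by (intro ex_cong1 conj_cong refl) auto

lemma agree_local: "t \<le> n \<Longrightarrow> agree (S \<inter> {..<n}) r u t \<longleftrightarrow> agree S r u t"
  unfolding agree_def using touched_in_local[of t n S r]
  by (intro ex_cong1 conj_cong refl) auto

lemma frozen_local: "s \<le> n \<Longrightarrow> frozen (S \<inter> {..<n}) r w s \<longleftrightarrow> frozen S r w s"
  unfolding frozen_def using agree_local[of _ n S r]
  by (intro ex_cong1 conj_cong refl) auto

text \<open>This is the form of recursion that \<open>course_of_values\<close> solves.\<close>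

lemma chosen_local: "chosen (S \<inter> {..<n}) n \<longleftrightarrow> chosen S n"
  unfolding chosen_def claims_def using frozen_local[of n n S] by simp

lemma decidable_chosen: "decidable (\<lambda>z. chosen (set_decode (psnd z)) (pfst z))"
  unfolding chosen_def claims_def frozen_def agree_def touched_def touched_in_def
  by (intro computable_intros decidable_step decidable_edge verts_computable)

lemma decidable_agree:
  assumes "computable_set X" "computable f" "computable g" "computable h"
  shows "decidable (\<lambda>z. agree X (f z) (g z) (h z))"
proof -
  have "decidable (\<lambda>z. agree X (pfst z) (pfst (psnd z)) (psnd (psnd z)))"
    unfolding agree_def touched_def touched_in_def
    by (intro computable_intros decidable_step decidable_edge verts_computable assms(1))
  from decidable_compose[OF this computable_pair[OF assms(2) computable_pair[OF assms(3,4)]]]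
  show ?thesis by simp
qed

lemma chosen_iff:
  assumes "claims S r n" "r \<le> n" "\<And>r'. r' < r \<Longrightarrow> \<not> claims S r' n"
  shows "chosen S n \<longleftrightarrow> psnd r \<noteq> 0"
proof
  assume "chosen S n"
  then obtain r2 where r2: "psnd r2 \<noteq> 0" "claims S r2 n" "\<forall>r'<r2. \<not> claims S r' n"
    unfolding chosen_def by blast
  then have "r2 = r"
    using assms(1,3) by (meson nat_neq_iff)
  with r2(1) show "psnd r \<noteq> 0"
    by simp
next
  assume "psnd r \<noteq> 0"
  then show "chosen S n"
    unfolding chosen_def using assms by blast
qed

lemma finite_step_values: "finite {w. \<exists>t. step e t u w}"
proof (cases "\<exists>t w. step e t u w")
  case True
  then obtain t w where "step e t u w"
    by blast
  then have "{w. \<exists>t. step e t u w} \<subseteq> {w}"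
    using step_unique by blast
  then show ?thesis
    using finite_subset by blast
qed simp

section \<open>Finite injury for the constructed set\<close>

context
  fixes X :: "nat set"
  assumes X_computable: "computable_set X"
    and X_chosen: "\<And>n. n \<in> X \<longleftrightarrow> chosen X n"
    and locally_finite: "\<And>v. finite {y. (v, y) \<in> edges G}"
    and isolated_not_computable: "\<not> computable_set {v. isolated G v}"
begin

text \<open>Induction on priority: stronger requirements freeze finitely many vertices, with
  finitely many neighbours in all, so they interfere only finitely often. Infinitely many frozen
  vertices would then make isolation decidable.\<close>

lemma finite_frozen: "finite {w. \<exists>s. frozen X r w s}"
proof (induction r rule: less_induct)
  case (less r)
  let ?e = "pfst r"
  show ?case
  proof (rule ccontr)
    assume inf: "infinite {w. \<exists>s. frozen X r w s}"
    \<comment> \<open>If agreement up to \<open>N\<close> never occurred at such a stage, every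
      frozen vertex would be the value at some \<open>u \<le> N\<close>, and each \<open>u\<close>
      has at most one value.\<close>
    have late: "\<exists>t>N. r \<le> t \<and> (\<forall>u\<le>N. u \<in> verts G \<longrightarrow> agree X r u t)" for N
    proof (rule ccontr)
      assume *: "\<not> ?thesis"
      have "{w. \<exists>s. frozen X r w s} \<subseteq> (\<Union>u\<le>N. {w. \<exists>t. step ?e t u w})"
      proof
        fix w
        assume "w \<in> {w. \<exists>s. frozen X r w s}"
        then obtain t u where tu: "r \<le> t" "u < t" "step ?e t u w"
          "\<forall>u'<u. u' \<in> verts G \<longrightarrow> agree X r u' t"
          unfolding frozen_def by blast
        have "u \<le> N"
        proof (rule ccontr)
          assume "\<not> u \<le> N"
          with tu * show False
            by (meson le_less_trans less_trans not_le)
        qed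
        with tu(3) show "w \<in> (\<Union>u\<le>N. {w. \<exists>t. step ?e t u w})"
          by blast
      qed
      moreover have "finite (\<Union>u\<le>N. {w. \<exists>t. step ?e t u w})"
        using finite_step_values by simp
      ultimately show False
        using inf finite_subset by blast
    qed
    text \<open>
      From now on, a vertex \<open>u\<close> is isolated if it looks isolated at stage \<open>\<tau> u\<close>, unless its image \<open>W u\<close>
      has a neighbour in the set \<open>Z\<close> of vertices over which a stronger requirement may decide.
    \<close>
    define ready where "ready u t \<longleftrightarrow> u < t \<and> r \<le> t \<and> (\<forall>u'\<le>u. u' \<in> verts G \<longrightarrow> agree X r u' t)" for u t
    have ex_ready: "\<exists>t. ready u t" for u
      unfolding ready_def using late[of u] by blast
    define \<tau> where "\<tau> u = (LEAST t. ready u t)" for u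
    have ready: "ready u (\<tau> u)" for u
      unfolding \<tau>_def using ex_ready by (rule LeastI_ex)
    have \<tau>_computable: "computable \<tau>"
    proof -
      have "decidable (\<lambda>z. ready (pfst z) (psnd z))"
        unfolding ready_def by (intro computable_intros decidable_agree X_computable verts_computable)
      from computable_Least[OF this ex_ready] show ?thesis
        unfolding \<tau>_def .
    qed
    define W where "W u = (SOME w. w < \<tau> u \<and> step ?e (\<tau> u) u w \<and> (w \<in> X \<longleftrightarrow> psnd r = 0) \<and>
        (touched u (\<tau> u) \<longleftrightarrow> touched_in X r w (\<tau> u)) \<and>
        (\<forall>u'<u. u' \<in> verts G \<longrightarrow> \<not> step ?e (\<tau> u) u' w))" for u
    have W: "W u < \<tau> u" "step ?e (\<tau> u) u (W u)" "W u \<in> X \<longleftrightarrow> psnd r = 0"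
      "touched u (\<tau> u) \<longleftrightarrow> touched_in X r (W u) (\<tau> u)"
      "\<forall>u'<u. u' \<in> verts G \<longrightarrow> \<not> step ?e (\<tau> u) u' (W u)" if "u \<in> verts G" for u
    proof -
      have "agree X r u (\<tau> u)"
        using ready[of u] that unfolding ready_def by blast
      then have "\<exists>w. w < \<tau> u \<and> step ?e (\<tau> u) u w \<and> (w \<in> X \<longleftrightarrow> psnd r = 0) \<and>
        (touched u (\<tau> u) \<longleftrightarrow> touched_in X r w (\<tau> u)) \<and>
        (\<forall>u'<u. u' \<in> verts G \<longrightarrow> \<not> step ?e (\<tau> u) u' w)"
        unfolding agree_def by blast
      from someI_ex[OF this] show "W u < \<tau> u" "step ?e (\<tau> u) u (W u)" "W u \<in> X \<longleftrightarrow> psnd r = 0"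
      "touched u (\<tau> u) \<longleftrightarrow> touched_in X r (W u) (\<tau> u)"
      "\<forall>u'<u. u' \<in> verts G \<longrightarrow> \<not> step ?e (\<tau> u) u' (W u)"
        unfolding W_def by blast+
    qed
    \<comment> \<open>At stage \<open>\<tau> u\<close> the smaller \<open>u'\<close> agrees as well,
      so its value is already computed; \<open>agree\<close> at \<open>u\<close> forbids that it
      equals \<open>W u\<close>.\<close>
    have W_neq: "W u' \<noteq> W u" if "u' < u" "u' \<in> verts G" "u \<in> verts G" for u u'
    proof
      assume eq: "W u' = W u"
      have "agree X r u' (\<tau> u)"
        using ready[of u] that unfolding ready_def by simp
      then obtain w where "step ?e (\<tau> u) u' w"
        unfolding agree_def by blast
      moreover from this have "w = W u"
        using step_unique[OF _ W(2)[OF that(2)]] eq by simp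
      ultimately show False
        using W(5)[OF that(3)] that by blast
    qed
    have W_inj: "inj_on W (verts G)"
      by (rule linorder_inj_onI) (use W_neq in auto)
    define Z where "Z = (\<Union>r'<r. \<Union>w\<in>{w. \<exists>s. frozen X r' w s}. {y. (w, y) \<in> edges G})"
    have "finite Z"
      unfolding Z_def using less locally_finite by auto
    \<comment> \<open>These exceptions are finitely many because \<open>W\<close> is injective and
      \<open>Z\<close> is finite with finite degrees.\<close>
    define U where "U = {u \<in> verts G. W u \<in> (\<Union>z\<in>Z. {y. (z, y) \<in> edges G})}"
    have "finite U"
    proof -
      have "finite (\<Union>z\<in>Z. {y. (z, y) \<in> edges G})"
        using \<open>finite Z\<close> locally_finite by auto
      moreover have "inj_on W U"
        using W_inj unfolding U_def by (rule inj_on_subset) auto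
      moreover have "W ` U \<subseteq> (\<Union>z\<in>Z. {y. (z, y) \<in> edges G})"
        unfolding U_def by auto
      ultimately show ?thesis
        by (meson finite_imageD finite_subset)
    qed
    \<comment> \<open>\<open>W u\<close> has no neighbour in its own part below
      \<open>\<tau> u\<close>, and later ones are sent away, as \<open>r\<close> is their strongest
      claimant. A neighbour of \<open>u\<close> would thus destroy agreement at \<open>u\<close> for
      good, against \<open>late\<close>.\<close>
    have isolated: "isolated G u" if u: "u \<in> verts G" "u \<notin> U" "\<not> touched u (\<tau> u)" for u
    proof (rule ccontr)
      assume "\<not> isolated G u"
      then obtain y where y: "(u, y) \<in> edges G"
        using u(1) unfolding isolated_def neighbours_eq by auto
      have frozen: "frozen X r (W u) s" if "\<tau> u \<le> s" for s
      proof (rule frozenI[of "\<tau> u" s r "W u" X u])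
        show "r \<le> \<tau> u" "u < \<tau> u" "\<And>u'. u' < u \<Longrightarrow> u' \<in> verts G \<Longrightarrow> agree X r u' (\<tau> u)"
          using ready[of u] unfolding ready_def by simp_all
      qed (fact that u(1) W[OF u(1)])+
      have no: "\<not> (z \<in> X \<longleftrightarrow> psnd r = 0)" if z: "(W u, z) \<in> edges G" for z
      proof (cases "z < \<tau> u")
        case True
        have "\<not> touched_in X r (W u) (\<tau> u)"
          using W(4)[OF u(1)] u(3) by simp
        with True z show ?thesis
          unfolding touched_in_def by simp
      next
        case False
        then have "claims X r z"
          unfolding claims_def using z frozen W(1)[OF u(1)] by (intro exI[of _ "W u"]) auto
        moreover have "r \<le> z"
          using False ready[of u] unfolding ready_def by simp
        moreover have "\<not> claims X r' z" if "r' < r" for r'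
        proof
          assume "claims X r' z"
          then have "z \<in> Z"
            unfolding claims_def Z_def using that by blast
          then show False
            using u(1,2) edge_sym[OF z] unfolding U_def by blast
        qed
        ultimately show ?thesis
          using chosen_iff X_chosen by blast
      qed
      obtain t where t: "t > max u y" "agree X r u t"
        using late[of "max u y"] u(1) by auto
      then obtain w where w: "step ?e t u w" "touched u t \<longleftrightarrow> touched_in X r w t"
        unfolding agree_def by blast
      have "w = W u"
        using step_unique[OF w(1) W(2)[OF u(1)]] .
      moreover have "touched u t"
        unfolding touched_def using t(1) y by auto
      ultimately have "touched_in X r (W u) t"
        using w(2) by simp
      then obtain z where "(W u, z) \<in> edges G" "z \<in> X \<longleftrightarrow> psnd r = 0"
        unfolding touched_in_def by (elim exE conjE)
      then show False
        using no by simp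
    qed
    have "decidable (\<lambda>u. u \<in> verts G \<and> \<not> touched u (\<tau> u))"
      unfolding touched_def
      by (intro computable_intros decidable_edge verts_computable \<tau>_computable
          computable_compose[OF \<tau>_computable])
    then have "computable_set {u. u \<in> verts G \<and> \<not> touched u (\<tau> u)}"
      by (rule computable_set_Collect)
    \<comment> \<open>An isolated vertex is never touched, so the two sets can differ only on
      \<open>U\<close>.\<close>
    moreover have "{v. isolated G v} - U = {u. u \<in> verts G \<and> \<not> touched u (\<tau> u)} - U"
      using isolated by (auto simp: isolated_def neighbours_eq touched_def)
    ultimately show False
      using computable_set_finite_difference \<open>finite U\<close> isolated_not_computable by blast
  qed
qed

text \<open>The requirement is that of the inverse \<open>g\<close> of the isomorphism. Agreement
  eventually holds at every vertex, so every \<open>g u\<close> gets frozen, and these are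
  infinitely many.\<close>

lemma not_computably_isomorphic:
  assumes inf: "infinite (verts G)"
  shows "\<not> computably_isomorphic (induced_subgraph G {v \<in> verts G. v \<in> X \<longleftrightarrow> p = (0::nat)}) G"
proof
  let ?Y = "{v \<in> verts G. v \<in> X \<longleftrightarrow> p = (0::nat)}"
  assume "computably_isomorphic (induced_subgraph G ?Y) G"
  then obtain f where f: "computable f" and iso: "graph_iso f (induced_subgraph G ?Y) G"
    unfolding computably_isomorphic_def by blast
  have inj: "inj_on f ?Y" and img: "f ` ?Y = verts G"
    using iso by (auto simp: graph_iso_def induced_subgraph_def bij_betw_def)
  \<comment> \<open>The first disjunct lets the search stop at 0 off \<open>verts G\<close>, so
    \<open>g\<close> is total.\<close>
  define g where "g u = (LEAST w. u \<notin> verts G \<or> w \<in> ?Y \<and> f w = u)" for u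
  have ex: "\<exists>w. u \<notin> verts G \<or> w \<in> ?Y \<and> f w = u" for u
    using induced_iso_preimage[OF iso] by blast
  have g: "g u \<in> ?Y" "f (g u) = u" if "u \<in> verts G" for u
    using LeastI_ex[OF ex[of u]] that unfolding g_def by blast+
  have "decidable (\<lambda>z. pfst z \<notin> verts G \<or>
      (psnd z \<in> verts G \<and> (psnd z \<in> X \<longleftrightarrow> p = 0)) \<and> f (psnd z) = pfst z)"
    by (intro computable_intros verts_computable X_computable computable_compose[OF f])
  then have "decidable (\<lambda>z. pfst z \<notin> verts G \<or> psnd z \<in> ?Y \<and> f (psnd z) = pfst z)"
    by simp
  from computable_Least[OF this ex] have "computable g"
    unfolding g_def .
  then obtain e where e: "\<And>x y. Some (g x) = Some y \<longleftrightarrow> (\<exists>t. step e t x y)"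
    unfolding computable_def using partial_computable_step by blast
  define r where "r = prod_encode (e, p)"
  have r: "pfst r = e" "psnd r = p"
    by (simp_all add: r_def)
  have edge_g: "(u, y) \<in> edges G \<longleftrightarrow> (g u, g y) \<in> edges G" if "u \<in> verts G" "y \<in> verts G" for u y
    using induced_iso_edge[OF iso g(1)[OF that(1)] g(1)[OF that(2)]] g(2) that by simp
  have g_inj: "g u' \<noteq> g u" if "u' \<in> verts G" "u \<in> verts G" "u' \<noteq> u" for u u'
    using g(2) that by metis
  have "\<exists>t0. \<forall>t\<ge>t0. agree X r u t" if u: "u \<in> verts G" for u
  proof -
    obtain ts where ts: "step e ts u (g u)"
      using e by blast
    \<comment> \<open>A neighbour \<open>y\<close> of \<open>u\<close> gives the neighbour
      \<open>g y\<close> of \<open>g u\<close> in the same part; conversely \<open>f\<close> carries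
      neighbours of \<open>g u\<close> in that part to neighbours of \<open>u\<close>.\<close>
    obtain tn where tn: "\<forall>t\<ge>tn. touched u t \<longleftrightarrow> touched_in X r (g u) t"
    proof (cases "\<exists>y. (u, y) \<in> edges G")
      case True
      then obtain y where y: "(u, y) \<in> edges G"
        by blast
      then have "y \<in> verts G"
        using edge_verts by blast
      with y have "(g u, g y) \<in> edges G" "g y \<in> X \<longleftrightarrow> p = 0"
        using edge_g u g(1) by auto
      with y have "\<forall>t\<ge>Suc (y + g y). touched u t \<longleftrightarrow> touched_in X r (g u) t"
        unfolding touched_def touched_in_def r by (metis Suc_le_lessD add_lessD1 trans_le_add2 le_less_trans le_add2)
      then show thesis
        by (rule that)
    next
      case False
      have "(g u, z) \<notin> edges G" if z: "z \<in> X \<longleftrightarrow> p = 0" for z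
      proof
        assume gz: "(g u, z) \<in> edges G"
        then have "z \<in> ?Y"
          using z edge_verts by blast
        then have "(f (g u), f z) \<in> edges G"
          using induced_iso_edge[OF iso g(1)[OF u]] gz by blast
        with False g(2)[OF u] show False
          by auto
      qed
      with False have "\<forall>t\<ge>0. touched u t \<longleftrightarrow> touched_in X r (g u) t"
        unfolding touched_def touched_in_def r by blast
      then show thesis
        by (rule that)
    qed
    have "agree X r u t" if t: "Suc (ts + g u + tn) \<le> t" for t
      unfolding agree_def r
    proof (intro exI[of _ "g u"] conjI allI impI)
      show "step e t u (g u)"
        using step_mono[OF ts] t by simp
      show "touched u t \<longleftrightarrow> touched_in X r (g u) t"
        using tn t by simp
      show "\<not> step e t u' (g u)" if "u' < u" "u' \<in> verts G" for u'
        using e[of u' "g u"] g_inj[OF that(2) u] that(1) by auto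
    qed (use t g(1)[OF u] in auto)
    then show ?thesis
      by blast
  qed
  then obtain T where T: "\<And>u t. u \<in> verts G \<Longrightarrow> T u \<le> t \<Longrightarrow> agree X r u t"
    by metis
  have "g u \<in> {w. \<exists>s. frozen X r w s}" if u: "u \<in> verts G" for u
  proof -
    obtain ts where ts: "step e ts u (g u)"
      using e by blast
    \<comment> \<open>The sum bounds every single \<open>T u'\<close>, so all vertices below
      \<open>u\<close> agree at this stage; the other summands meet the remaining bounds in
      \<open>frozenI\<close>.\<close>
    define t where "t = Suc (u + r + g u + ts + (\<Sum>u'<u. T u'))"
    have "agree X r u' t" if "u' < u" "u' \<in> verts G" for u'
    proof (rule T[OF that(2)])
      have "T u' \<le> (\<Sum>u'<u. T u')"
        using that(1) by (intro member_le_sum) auto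
      then show "T u' \<le> t"
        unfolding t_def by simp
    qed
    moreover have "step e t u (g u)"
      using step_mono[OF ts] by (simp add: t_def)
    ultimately have "frozen X r (g u) t"
      using u g(1)[OF u] by (intro frozenI[of t t r "g u" X u]) (simp_all add: r, simp_all add: t_def)
    then show ?thesis
      by blast
  qed
  then have "g ` verts G \<subseteq> {w. \<exists>s. frozen X r w s}"
    by blast
  then have "finite (g ` verts G)"
    using finite_frozen finite_subset by blast
  moreover have "inj_on g (verts G)"
    using g_inj by (meson inj_onI)
  ultimately show False
    using inf finite_imageD by blast
qed

end

lemma locally_finite_partition:
  assumes "infinite (verts G)" "\<And>v. finite (neighbours G v)"
    and "\<not> computable_set {v. isolated G v}"
  shows "\<exists>X0 X1. computable_partition (verts G) X0 X1 \<and>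
           \<not> computably_isomorphic (induced_subgraph G X0) G \<and>
           \<not> computably_isomorphic (induced_subgraph G X1) G"
proof -
  obtain X where X: "computable_set X" "\<forall>n. n \<in> X \<longleftrightarrow> chosen (X \<inter> {..<n}) n"
    using course_of_values[of "\<lambda>n S. chosen S n", OF decidable_chosen] by blast
  then have "n \<in> X \<longleftrightarrow> chosen X n" for n
    by (simp add: chosen_local)
  note not_iso = not_computably_isomorphic[OF X(1) this assms(2)[unfolded neighbours_eq] assms(3,1)]
  have "{v \<in> verts G. v \<in> X \<longleftrightarrow> 0 = (0::nat)} = verts G \<inter> X"
    "{v \<in> verts G. v \<in> X \<longleftrightarrow> 1 = (0::nat)} = verts G - X"
    by auto
  with not_iso[of 0] not_iso[of 1]
  have "\<not> computably_isomorphic (induced_subgraph G (verts G \<inter> X)) G"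
    "\<not> computably_isomorphic (induced_subgraph G (verts G - X)) G"
    by simp_all
  moreover have "computable_partition (verts G) (verts G \<inter> X) (verts G - X)"
    using computable_set_Int[OF verts_computable X(1)] computable_set_Diff[OF verts_computable X(1)]
    unfolding computable_partition_def by blast
  ultimately show ?thesis
    by blast
qed

end

text \<open>A one-vertex graph has to be excluded: one part of each partition of it is the whole
  graph.\<close>

theorem theorem4p1:
  fixes G :: graph
  assumes "computable_graph G"
    and "\<exists>v. isolated G v"
    and "\<not> isomorphic G edgeless_omega"
    and "\<not> is_singleton (verts G)"
    and "comp_enumerable (finite_degree_verts G)"
  shows "\<exists>X0 X1. computable_partition (verts G) X0 X1 \<and>
           \<not> computably_isomorphic (induced_subgraph G X0) G \<and>
           \<not> computably_isomorphic (induced_subgraph G X1) G"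
proof -
  interpret computable_graph_on_nat G
    using assms(1) by unfold_locales
  obtain v where v: "isolated G v"
    using assms(2) by blast
  then have v_vert: "v \<in> verts G"
    by (simp add: isolated_def)
  let ?I = "{v. isolated G v}"
  consider (fin) "finite (verts G)"
    | (comp) "infinite (verts G)" "computable_set ?I"
    | (inf_deg) u where "u \<in> verts G" "infinite (neighbours G u)"
    | (loc_fin) "infinite (verts G)" "\<not> computable_set ?I" "\<And>u. finite (neighbours G u)"
    \<comment> \<open>Non-vertices have no neighbours, so finite degree at all vertices gives it for
      all numbers.\<close>
    using edge_verts by (metis (no_types, lifting) Collect_empty_eq finite.emptyI neighbours_eq)
  then show ?thesis
  proof cases
    case fin
    \<comment> \<open>For a finite graph any split into two nonempty parts works, by counting; a
      second vertex exists by \<open>assms(4)\<close>.\<close>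
    have "{v} \<subset> verts G" "verts G - {v} \<subset> verts G"
      using v_vert assms(4) by (auto simp: is_singleton_def)
    moreover have "computable_partition (verts G) {v} (verts G - {v})"
      using v_vert fin computable_set_finite unfolding computable_partition_def by auto
    ultimately show ?thesis
      using not_iso_if_finite[OF fin] unfolding computably_isomorphic_def by blast
  next
    case comp
    have "edges G \<noteq> {}"
    proof
      assume empty: "edges G = {}"
      \<comment> \<open>An infinite edgeless graph is isomorphic to \<open>edgeless_omega\<close> by
        numbering its vertices in increasing order.\<close>
      have "bij_betw (inv_into UNIV (enumerate (verts G))) (verts G) UNIV"
        using bij_betw_inv_into[OF bij_enumerate[OF comp(1)]] .
      then have "graph_iso (inv_into UNIV (enumerate (verts G))) G edgeless_omega"
        by (simp add: graph_iso_def edgeless_omega_def empty)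
      with assms(3) show False
        unfolding isomorphic_def by blast
    qed
    then obtain a b where ab: "(a, b) \<in> edges G"
      by auto
    have "\<exists>y\<in>verts G - ?I. (x, y) \<in> edges G" if x: "x \<in> verts G - ?I" for x
    proof -
      obtain y where "(x, y) \<in> edges G"
        using x unfolding isolated_def neighbours_eq by auto
      moreover from this have "\<not> isolated G y"
        using edge_sym unfolding isolated_def neighbours_eq by blast
      ultimately show ?thesis
        using edge_verts by blast
    qed
    note not_iso0 = not_iso_if_no_isolated[OF v this]
    have "(x, y) \<notin> edges G" if "x \<in> ?I" "y \<in> ?I" for x y
      using that unfolding isolated_def neighbours_eq by blast
    note not_iso1 = not_iso_if_edgeless[OF ab this]
    have "computable_partition (verts G) (verts G - ?I) ?I"
      using comp(2) computable_set_Diff[OF verts_computable comp(2)]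
      unfolding computable_partition_def
      using isolated_def by blast
    then show ?thesis
      using not_iso0 not_iso1 unfolding computably_isomorphic_def by blast
  next
    case inf_deg
    show ?thesis
      by (rule infinite_degree_partition[OF v inf_deg assms(5)])
  next
    case loc_fin
    show ?thesis
      by (rule locally_finite_partition[OF loc_fin(1,3,2)])
  qed
qed

end
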